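(* Let $q$ be a power of a prime $p$. If there exists a pure $\mathbf{F}_q$-linear $[[n,k,r,d]]_q$ subsystem code with $r>0$, then there exists a pure $\mathbf{F}_q$-linear $[[n,k+1,r-1,d]]_q$ subsystem code.
   Context: For $(x|y)\in\mathbf{F}_q^{2n}$ (with $x,y\in\mathbf{F}_q^n$), $\mathrm{swt}(x|y)$ is the number of $i$ with $(x_i,y_i)\ne(0,0)$, and $\mathrm{swt}(S)$ is the minimum of $\mathrm{swt}$ over the nonzero elements of $S$. The trace-symplectic product of $(a|b)$ and $(a'|b')$ is $\mathrm{tr}_{q/p}(a'\cdot b-a\cdot b')$, and $C^{\perp_s}$ is the dual of $C\subseteq\mathbf{F}_q^{2n}$ with respect to it. All subsystem codes are Clifford subsystem codes: an $((n,K,R,d))_q$ subsystem code is a subspace $Q=A\otimes B$ of $\mathbf{C}^{q^n}$, $\dim A=K$, $\dim B=R$, arising from an additive code; concretely, its existence means that there is an additive subgroup $C\le\mathbf{F}_q^{2n}$ (the zero code is allowed) with $D=C\cap C^{\perp_s}$ such that $|C|=q^nR/K$, $|D|=q^n/(KR)$, and $d=\mathrm{swt}(D^{\perp_s}\setminus C)$ if $D^{\perp_s}\ne C$, while $d=\mathrm{swt}(D^{\perp_s})$ if $D^{\perp_s}=C$ (the case $K=1$). The subsystem code is $\mathbf{F}_q$-linear if $C$ is an $\mathbf{F}_q$-linear subspace of $\mathbf{F}_q^{2n}$. $[[n,k,r,d]]_q$ means $((n,q^k,q^r,d))_q$. The code derived from $C$ is pure to $d'$ if $C$ contains no nonzero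 element of symplectic weight less than $d'$; it is pure if it is pure to its minimum distance $d$. *)

theory Defs
  imports "HOL-Analysis.Analysis" "HOL-Computational_Algebra.Primes"
begin

text \<open>
  The field \<open>F\<^sub>q\<close> is a type \<open>'a :: finite_field\<close> with \<open>q = CARD('a)\<close>, and \<open>n = CARD('n)\<close>.
  A vector \<open>(x|y)\<close> of \<open>F\<^sub>q\<^sup>2\<^sup>n\<close> is indexed by the sum type \<open>'n + 'n\<close>: its left components
  (indices \<open>Inl i\<close>) form \<open>x\<close> and its right components (indices \<open>Inr i\<close>) form \<open>y\<close>.
  \<open>F\<^sub>q\<close>-linear subspaces are then the sets satisfying \<^const>\<open>vec.subspace\<close>.
\<close>

type_synonym ('a, 'n) spvec = "'a ^ ('n + 'n)"

text \<open>The trace from \<open>F\<^sub>q\<close>, \<open>q = p\<^sup>m\<close>, to the prime field \<open>F\<^sub>p\<close> is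
  \<open>x + x\<^sup>p + \<dots> + x^(p^(m-1))\<close>; its value is regarded as an element of \<open>F\<^sub>q\<close>.\<close>

definition abs_degree :: "'a::finite_field itself \<Rightarrow> nat" where
  "abs_degree _ = (THE m. CARD('a) = CHAR('a) ^ m)"

definition abs_trace :: "'a::finite_field \<Rightarrow> 'a" where
  "abs_trace x = (\<Sum>i<abs_degree TYPE('a). x ^ (CHAR('a) ^ i))"

definition swt :: "('a::finite_field, 'n::finite) spvec \<Rightarrow> nat" where
  "swt v = card {i :: 'n. (v $ Inl i, v $ Inr i) \<noteq> (0, 0)}"

text \<open>This minimum is meaningful only if \<open>S\<close> has a nonzero element.\<close>

definition min_swt :: "('a::finite_field, 'n::finite) spvec set \<Rightarrow> nat" where
  "min_swt S = Min (swt ` (S - {0}))"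

definition trace_symp :: "('a::finite_field, 'n::finite) spvec \<Rightarrow> ('a, 'n) spvec \<Rightarrow> 'a" where
  "trace_symp v w =
     abs_trace ((\<Sum>i\<in>UNIV. w $ Inl i * v $ Inr i) - (\<Sum>i\<in>UNIV. v $ Inl i * w $ Inr i))"

definition symp_dual :: "('a::finite_field, 'n::finite) spvec set \<Rightarrow> ('a, 'n) spvec set" where
  "symp_dual C = {v. \<forall>w\<in>C. trace_symp v w = 0}"

definition additive_code :: "('a::finite_field, 'n::finite) spvec set \<Rightarrow> bool" where
  "additive_code C \<longleftrightarrow> 0 \<in> C \<and> (\<forall>v\<in>C. \<forall>w\<in>C. v + w \<in> C) \<and> (\<forall>v\<in>C. - v \<in> C)"

text \<open>\<open>C\<close> gives rise to a Clifford subsystem code with parameters \<open>((n,K,R,d))\<^sub>q\<close>.\<close>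

definition subsystem_code ::
  "('a::finite_field, 'n::finite) spvec set \<Rightarrow> nat \<Rightarrow> nat \<Rightarrow> nat \<Rightarrow> nat \<Rightarrow> bool" where
  "subsystem_code C n K R d \<longleftrightarrow>
     (let q = CARD('a); D = C \<inter> symp_dual C in
        n = CARD('n) \<and> K > 0 \<and> R > 0 \<and> additive_code C \<and>
        real (card C) = real q ^ n * real R / real K \<and>
        real (card D) = real q ^ n / (real K * real R) \<and>
        d = (if symp_dual D \<noteq> C then min_swt (symp_dual D - C) else min_swt (symp_dual D)))"

definition pure_to :: "('a::finite_field, 'n::finite) spvec set \<Rightarrow> nat \<Rightarrow> bool" where
  "pure_to C d \<longleftrightarrow> (\<forall>c\<in>C. c \<noteq> 0 \<longrightarrow> \<not> swt c < d)"

text \<open>\<open>C\<close> gives rise to a pure \<open>F\<^sub>q\<close>-linear \<open>[[n,k,r,d]]\<^sub>q\<close> subsystem code.\<close>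

definition pure_linear_subsystem_code ::
  "('a::finite_field, 'n::finite) spvec set \<Rightarrow> nat \<Rightarrow> nat \<Rightarrow> nat \<Rightarrow> nat \<Rightarrow> bool" where
  "pure_linear_subsystem_code C n k r d \<longleftrightarrow>
     subsystem_code C n (CARD('a) ^ k) (CARD('a) ^ r) d \<and> vec.subspace C \<and> pure_to C d"

end

theory Submission
  imports Defs
begin

text \<open>
  Let \<open>D = C \<inter> C\<^sup>\<perp>\<close>. Cutting \<open>C\<close> down by a hyperbolic pair \<open>c, f \<in> C\<close> to
  \<open>C' = C \<inter> {c, f}\<^sup>\<perp>\<close> leaves the radical \<open>D\<close> unchanged and divides \<open>|C|\<close> by \<open>q\<^sup>2\<close>, so
  only the minimum distance is at stake. Purity shows that \<open>D\<^sup>\<perp>\<close> has no nonzero vector of weight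
  below \<open>d\<close>. If \<open>D\<^sup>\<perp> \<noteq> C\<close>, a vector of weight \<open>d\<close> outside \<open>C\<close> stays outside \<open>C'\<close>.

  If \<open>D\<^sup>\<perp> = C\<close>, one takes for \<open>c\<close> a vector of weight \<open>d\<close>, which requires that such a vector
  exists in \<open>C - D\<close>. If all of them lie in \<open>D\<close>, then \<open>C\<close> is first replaced by its image under the
  symplectic map \<open>g u = u + \<omega>(u,e) l + \<omega>(u,l) e\<close>, where \<open>l\<close> is supported on one coordinate, \<open>\<omega>(c,l) \<noteq> 0\<close>
  for some \<open>c \<in> D\<close> of weight \<open>d\<close>, and \<open>e \<in> C - D\<close> is orthogonal to \<open>l\<close>. Since \<open>g C\<close>
  consists of the vectors \<open>u + \<omega>(u,e) l\<close> with \<open>u \<in> C\<close>, a weight can drop by at most one, and only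
  for \<open>u \<notin> D\<close>, that is, from at least \<open>d + 1\<close>; and \<open>c\<close> now lies in \<open>g C - g D\<close>.
\<close>

section \<open>The symplectic form and the trace\<close>

text \<open>Translation by 1 permutes the ring, so the sum of all elements equals itself plus
  \<open>CARD('a)\<close> times 1.\<close>

lemma CHAR_dvd_CARD: "CHAR('a::{finite, comm_ring_1}) dvd CARD('a)"
proof -
  have "bij (\<lambda>x::'a. x + 1)"
    by (rule bij_betwI[where g = "\<lambda>x. x - 1"]) auto
  then have "(\<Sum>x\<in>UNIV. x + 1) = (\<Sum>x\<in>UNIV. x :: 'a)"
    by (rule sum.reindex_bij_betw)
  then have "of_nat CARD('a) = (0::'a)" by (simp add: sum.distrib)
  then show ?thesis by (simp add: of_nat_eq_0_iff_char_dvd)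
qed

lemma card_eq_CHAR_power:
  assumes "prime p" and "m > 0" and "CARD('a::finite_field) = p ^ m"
  shows "CARD('a) = CHAR('a) ^ m"
proof -
  have pr: "prime CHAR('a)"
    by (rule prime_CHAR_semidom) simp
  have "CHAR('a) dvd p ^ m"
    using CHAR_dvd_CARD[where 'a='a] assms(3) by simp
  then have "CHAR('a) dvd p"
    using pr prime_dvd_power by blast
  then have "CHAR('a) = p"
    using pr assms(1) primes_dvd_imp_eq by blast
  then show ?thesis using assms(3) by simp
qed

lemma abs_degree_eq:
  assumes "CARD('a::finite_field) = CHAR('a) ^ m"
  shows "abs_degree TYPE('a) = m"
proof -
  have "prime CHAR('a)"
    by (rule prime_CHAR_semidom) simp
  then have "CHAR('a) > 1" by (rule prime_gt_1_nat)
  then show ?thesis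
    unfolding abs_degree_def assms by (intro the_equality) auto
qed

text \<open>The trace is a polynomial function of degree at most \<open>c ^ (m - 1)\<close>, less
  than the size of the field, and its linear coefficient is 1. A nonzero polynomial of that degree
  cannot vanish everywhere.\<close>

lemma abs_trace_nonzero:
  assumes "CARD('a::finite_field) = CHAR('a) ^ m" and "m > 0"
  shows "\<exists>x::'a. abs_trace x \<noteq> 0"
proof (rule ccontr)
  assume "\<not> ?thesis"
  then have tr0: "abs_trace x = 0" for x :: 'a by simp
  define c where "c = CHAR('a)"
  have "prime CHAR('a)"
    by (rule prime_CHAR_semidom) simp
  then have c1: "c > 1" unfolding c_def by (rule prime_gt_1_nat)
  define P :: "'a poly" where "P = (\<Sum>i<m. monom 1 (c ^ i))"
  have root: "poly P x = 0" for x
    using tr0[of x] unfolding abs_trace_def abs_degree_eq[OF assms(1)] P_def c_def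
    by (simp add: poly_sum poly_monom)
  have "coeff P 1 = (\<Sum>i<m. if i = 0 then 1 else 0)"
    unfolding P_def using c1 by (auto simp: coeff_sum intro!: sum.cong)
  also have "\<dots> = 1" using assms(2) by simp
  finally have P0: "P \<noteq> 0" by auto
  have "degree P \<le> c ^ (m - 1)"
    unfolding P_def
  proof (rule degree_sum_le)
    fix i assume "i \<in> {..<m}"
    then have "c ^ i \<le> c ^ (m - 1)" using c1 by (intro power_increasing) auto
    then show "degree (monom (1::'a) (c ^ i)) \<le> c ^ (m - 1)"
      by (simp add: degree_monom_eq)
  qed simp
  also have "c ^ (m - 1) < c ^ m" using c1 assms(2) by (intro power_strict_increasing) auto
  finally have "degree P < CARD('a)" using assms(1) by (simp add: c_def)
  then show False using card_poly_roots_bound[OF P0] root by simp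
qed

section \<open>The field-valued bilinear form behind the trace-symplectic product\<close>

definition symp_form :: "('a::finite_field, 'n::finite) spvec \<Rightarrow> ('a, 'n) spvec \<Rightarrow> 'a" where
  "symp_form v w = (\<Sum>i\<in>UNIV. w $ Inl i * v $ Inr i) - (\<Sum>i\<in>UNIV. v $ Inl i * w $ Inr i)"

lemma symp_add_left: "symp_form (u + v) w = symp_form u w + symp_form v w"
  by (simp add: symp_form_def algebra_simps sum.distrib)

lemma symp_scale_left: "symp_form (a *s v) w = a * symp_form v w"
  by (simp add: symp_form_def algebra_simps sum_distrib_left)

lemma symp_swap: "symp_form v w = - symp_form w v"
  by (simp add: symp_form_def algebra_simps)

lemma symp_add_right: "symp_form w (u + v) = symp_form w u + symp_form w v"
  by (simp add: symp_form_def algebra_simps sum.distrib)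

lemma symp_scale_right: "symp_form w (a *s v) = a * symp_form w v"
  by (simp add: symp_form_def algebra_simps sum_distrib_left)

lemma symp_self [simp]: "symp_form v v = 0"
  by (simp add: symp_form_def mult.commute)

lemma symp_zero [simp]: "symp_form 0 v = 0" "symp_form v 0 = 0"
  by (simp_all add: symp_form_def)

lemmas symp_linear = symp_add_left symp_add_right symp_scale_left symp_scale_right

lemma symp_eq_0_commute: "symp_form v w = 0 \<longleftrightarrow> symp_form w v = 0"
  using symp_swap[of v w] by simp

lemma symp_dual_subspace_eq:
  fixes S :: "('a::finite_field, 'n::finite) spvec set"
  assumes S: "vec.subspace S" and tr: "\<exists>x::'a. abs_trace x \<noteq> 0"
  shows "symp_dual S = {v. \<forall>w\<in>S. symp_form v w = 0}"
proof -
  have tr0: "abs_trace (0::'a) = 0"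
    by (simp add: abs_trace_def power_0_left)
  have "symp_form v w = 0" if v: "\<forall>w\<in>S. abs_trace (symp_form v w) = 0" and w: "w \<in> S" for v w
  proof (rule ccontr)
    assume nz: "symp_form v w \<noteq> 0"
    obtain x :: 'a where x: "abs_trace x \<noteq> 0" using tr by blast
    have "(x / symp_form v w) *s w \<in> S" using S w by (rule vec.subspace_scale)
    then have "abs_trace (symp_form v ((x / symp_form v w) *s w)) = 0" using v by blast
    then show False using x nz by (simp add: symp_scale_right)
  qed
  then show ?thesis
    by (auto simp: symp_dual_def trace_symp_def symp_form_def[symmetric] tr0)
qed

lemma subspace_symp_orthogonal: "vec.subspace {v. \<forall>w\<in>S. symp_form v w = 0}"
  by (rule vec.subspaceI) (auto simp: symp_linear)

lemma symp_unit_vectors: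
  "symp_form v (axis (Inr i) 1) = - (v $ Inl i)" "symp_form v (axis (Inl i) 1) = v $ Inr i"
  by (simp_all add: symp_form_def axis_def if_distrib[where f="\<lambda>x. x * _"] 
      if_distrib[where f="\<lambda>x. _ * x"] sum.delta cong: if_cong)

section \<open>Removing a hyperbolic pair\<close>

definition orth_pair ::
  "('a::finite_field, 'n::finite) spvec set \<Rightarrow> ('a, 'n) spvec \<Rightarrow> ('a, 'n) spvec \<Rightarrow> ('a, 'n) spvec set"
  where "orth_pair C c f = {x \<in> C. symp_form x c = 0 \<and> symp_form x f = 0}"

lemma subspace_orth_pair: "vec.subspace C \<Longrightarrow> vec.subspace (orth_pair C c f)"
  by (auto simp: vec.subspace_def orth_pair_def symp_linear)

text \<open>The form is nondegenerate on the plane spanned by \<open>c\<close> and \<open>f\<close>,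
  so subtracting the projection to that plane leaves a vector orthogonal to both.\<close>

lemma hyperbolic_decomposition:
  assumes C: "vec.subspace C" and cf: "c \<in> C" "f \<in> C" "symp_form c f \<noteq> 0" and x: "x \<in> C"
  obtains y s t where "y \<in> orth_pair C c f" "x = y + (s *s c + t *s f)"
proof -
  define s t where "s = symp_form x f / symp_form c f" and "t = symp_form x c / symp_form f c"
  define y where "y = x - (s *s c + t *s f)"
  have fc: "symp_form f c \<noteq> 0" using cf(3) symp_eq_0_commute by blast
  have xy: "x = y + (s *s c + t *s f)" by (simp add: y_def)
  have "symp_form x c = symp_form y c + t * symp_form f c" "symp_form x f = symp_form y f + s * symp_form c f"
    by (subst xy, simp add: symp_linear)+
  then have "symp_form y c = 0" "symp_form y f = 0" using cf(3) fc by (simp_all add: s_def t_def)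
  moreover have "y \<in> C"
    unfolding y_def using C cf x by (intro vec.subspace_diff vec.subspace_add vec.subspace_scale)
  ultimately show ?thesis using that xy by (auto simp: orth_pair_def)
qed

lemma card_orth_pair:
  fixes C :: "('a::finite_field, 'n::finite) spvec set"
  assumes C: "vec.subspace C" and cf: "c \<in> C" "f \<in> C" "symp_form c f \<noteq> 0"
  shows "card C = card (orth_pair C c f) * CARD('a)\<^sup>2"
proof -
  let ?h = "\<lambda>(y, s, t). y + (s *s c + t *s f)"
  let ?X = "orth_pair C c f \<times> (UNIV :: ('a \<times> 'a) set)"
  have fc: "symp_form f c \<noteq> 0" using cf(3) symp_eq_0_commute by blast
  have inj: "inj_on ?h ?X"
  proof (rule inj_onI)
    fix a b assume ab: "a \<in> ?X" "b \<in> ?X" "?h a = ?h b"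
    obtain y s t where a: "a = (y, s, t)" by (rule prod_cases3)
    obtain y' s' t' where b: "b = (y', s', t')" by (rule prod_cases3)
    have y: "y \<in> orth_pair C c f" "y' \<in> orth_pair C c f"
      and eq: "y + (s *s c + t *s f) = y' + (s' *s c + t' *s f)"
      using ab unfolding a b by auto
    \<comment> \<open>Pairing with \<open>c\<close> isolates \<open>t\<close>, pairing with
      \<open>f\<close> isolates \<open>s\<close>.\<close>
    have "t * symp_form f c = t' * symp_form f c" "s * symp_form c f = s' * symp_form c f"
      using arg_cong[OF eq, of "\<lambda>z. symp_form z c"] arg_cong[OF eq, of "\<lambda>z. symp_form z f"] y
      by (simp_all add: symp_linear orth_pair_def)
    then have "t = t'" "s = s'" using cf(3) fc by auto
    then show "a = b" using eq a b by simp
  qed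
  have "?h ` ?X = C"
  proof
    show "?h ` ?X \<subseteq> C"
      using C cf by (auto simp: orth_pair_def intro!: vec.subspace_add vec.subspace_scale)
    show "C \<subseteq> ?h ` ?X"
    proof
      fix x assume "x \<in> C"
      then obtain y s t where "y \<in> orth_pair C c f" "x = y + (s *s c + t *s f)"
        using hyperbolic_decomposition[OF C cf] by blast
      then show "x \<in> ?h ` ?X" by (intro image_eqI[of _ _ "(y, s, t)"]) auto
    qed
  qed
  then have "card C = card ?X" using card_image[OF inj] by simp
  then show ?thesis by (simp add: card_cartesian_product power2_eq_square flip: UNIV_Times_UNIV)
qed

lemma radical_orth_pair:
  assumes C: "vec.subspace C" and cf: "c \<in> C" "f \<in> C" "symp_form c f \<noteq> 0"
  shows "orth_pair C c f \<inter> {v. \<forall>w\<in>orth_pair C c f. symp_form v w = 0} = C \<inter> {v. \<forall>w\<in>C. symp_form v w = 0}"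
proof (intro equalityI subsetI)
  fix v assume v: "v \<in> orth_pair C c f \<inter> {v. \<forall>w\<in>orth_pair C c f. symp_form v w = 0}"
  have "symp_form v w = 0" if w: "w \<in> C" for w
  proof -
    obtain y s t where "y \<in> orth_pair C c f" "w = y + (s *s c + t *s f)"
      using hyperbolic_decomposition[OF C cf w] .
    then show ?thesis using v by (simp add: symp_linear orth_pair_def)
  qed
  then show "v \<in> C \<inter> {v. \<forall>w\<in>C. symp_form v w = 0}" using v by (auto simp: orth_pair_def)
qed (use cf in \<open>auto simp: orth_pair_def\<close>)

section \<open>Minimum weights and the parameters of the reduced code\<close>

lemma additive_code_subspace: "vec.subspace C \<Longrightarrow> additive_code C"
  by (simp add: additive_code_def vec.subspace_0 vec.subspace_add vec.subspace_neg)

lemma min_swt_eqI: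
  assumes "x \<in> S" "x \<noteq> 0" "swt x = d" and "\<And>y. y \<in> S \<Longrightarrow> y \<noteq> 0 \<Longrightarrow> d \<le> swt y"
  shows "min_swt S = d"
  unfolding min_swt_def using assms by (intro Min_eqI) auto

lemma min_swt_attained:
  assumes "S - {0} \<noteq> {}"
  obtains x where "x \<in> S" "x \<noteq> 0" "swt x = min_swt S"
  using Min_in[of "swt ` (S - {0})"] assms unfolding min_swt_def by fastforce

lemma min_swt_le: "x \<in> S \<Longrightarrow> x \<noteq> 0 \<Longrightarrow> min_swt S \<le> swt x"
  unfolding min_swt_def by (intro Min_le) auto

text \<open>All cases of the theorem end here. The witness \<open>x\<close> has weight
  \<open>d\<close> and lies outside the reduced code, so its distance is given by the first branch
  of the definition and cannot exceed \<open>d\<close>; \<open>wt\<close> gives the lower bound and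
  purity.\<close>

lemma orth_pair_code:
  fixes C :: "('a::finite_field, 'n::finite) spvec set"
  assumes tr: "\<exists>x::'a. abs_trace x \<noteq> 0"
    and C: "vec.subspace C" and cf: "c \<in> C" "f \<in> C" "symp_form c f \<noteq> 0"
    and n: "n = CARD('n)" and r: "r > 0"
    and D: "D = C \<inter> symp_dual C"
    and cardC: "real (card C) = real CARD('a) ^ n * real (CARD('a) ^ r) / real (CARD('a) ^ k)"
    and cardD: "real (card D) = real CARD('a) ^ n / (real (CARD('a) ^ k) * real (CARD('a) ^ r))"
    and wt: "\<And>x. x \<in> symp_dual D \<Longrightarrow> x \<noteq> 0 \<Longrightarrow> d \<le> swt x"
    and x: "x \<in> symp_dual D" "x \<notin> orth_pair C c f" "swt x = d"
  shows "pure_linear_subsystem_code (orth_pair C c f) n (k + 1) (r - 1) d"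
proof -
  let ?C = "orth_pair C c f"
  define q where "q = real CARD('a)"
  have q: "q > 0" by (simp add: q_def)
  obtain r' where r': "r = Suc r'" using r by (cases r) auto
  have sub: "vec.subspace ?C" using C by (rule subspace_orth_pair)
  have D': "?C \<inter> symp_dual ?C = D"
    unfolding D symp_dual_subspace_eq[OF C tr] symp_dual_subspace_eq[OF sub tr]
    using radical_orth_pair[OF C cf] .
  have subD: "vec.subspace D"
    unfolding D symp_dual_subspace_eq[OF C tr]
    using C subspace_symp_orthogonal by (rule vec.subspace_inter)
  have CD: "C \<subseteq> symp_dual D"
    unfolding symp_dual_subspace_eq[OF subD tr] unfolding D symp_dual_subspace_eq[OF C tr]
    by (auto simp: symp_eq_0_commute)
  have "real (card C) = real (card ?C) * q\<^sup>2"
    using card_orth_pair[OF C cf] by (simp add: q_def)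
  then have "real (card ?C) = q ^ n * q ^ r' / q ^ (k + 1)"
    using cardC q by (simp add: q_def[symmetric] r' field_simps power2_eq_square)
  moreover have "real (card D) = q ^ n / (q ^ (k + 1) * q ^ r')"
    using cardD q by (simp add: q_def[symmetric] r' field_simps)
  moreover have "x \<noteq> 0" using x(2) vec.subspace_0[OF sub] by blast
  then have "min_swt (symp_dual D - ?C) = d"
    using x wt by (intro min_swt_eqI[of x]) auto
  moreover have "symp_dual D \<noteq> ?C" using x by blast
  ultimately have "subsystem_code ?C n (CARD('a) ^ (k + 1)) (CARD('a) ^ (r - 1)) d"
    unfolding subsystem_code_def D' Let_def using n additive_code_subspace[OF sub]
    by (simp add: q_def r')
  moreover have "pure_to ?C d"
    using wt CD by (fastforce simp: pure_to_def orth_pair_def not_less)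
  ultimately show ?thesis using sub by (simp add: pure_linear_subsystem_code_def)
qed

section \<open>Moving a minimum weight vector out of the radical\<close>

text \<open>For orthogonal \<open>e\<close> and \<open>l\<close> this is a product of commuting
  transvections along \<open>e + l\<close>, \<open>e\<close> and \<open>l\<close>, with coefficients
  1, -1, -1.\<close>

definition sympl_shift ::
  "('a::finite_field, 'n::finite) spvec \<Rightarrow> ('a, 'n) spvec \<Rightarrow> ('a, 'n) spvec \<Rightarrow> ('a, 'n) spvec"
  where "sympl_shift e l u = u + (symp_form u e *s l + symp_form u l *s e)"

lemma symp_sympl_shift:
  assumes "symp_form e l = 0"
  shows "symp_form (sympl_shift e l u) (sympl_shift e l v) = symp_form u v"
proof -
  have "symp_form l e = 0" using assms symp_eq_0_commute by blast
  then show ?thesis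
    using assms symp_swap[of l v] symp_swap[of e v]
    by (simp add: sympl_shift_def symp_linear algebra_simps)
qed

text \<open>The map preserves the pairings with \<open>e\<close> and \<open>l\<close>, so the added
  terms can be read off from the image.\<close>

lemma inj_sympl_shift:
  assumes "symp_form e l = 0"
  shows "inj (sympl_shift e l)"
proof (rule injI)
  fix u v assume eq: "sympl_shift e l u = sympl_shift e l v"
  have le: "symp_form l e = 0" using assms symp_eq_0_commute by blast
  have "symp_form u e = symp_form v e" "symp_form u l = symp_form v l"
    using arg_cong[OF eq, of "\<lambda>z. symp_form z e"] arg_cong[OF eq, of "\<lambda>z. symp_form z l"] assms le
    by (simp_all add: sympl_shift_def symp_linear)
  then show "u = v" using eq by (simp add: sympl_shift_def)
qed

lemma subspace_sympl_shift:
  assumes "vec.subspace S"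
  shows "vec.subspace (sympl_shift e l ` S)"
proof (rule vec.subspaceI)
  show "0 \<in> sympl_shift e l ` S"
    by (rule image_eqI[of _ _ 0]) (use assms in \<open>auto simp: sympl_shift_def vec.subspace_0\<close>)
next
  fix x y assume "x \<in> sympl_shift e l ` S" "y \<in> sympl_shift e l ` S"
  then obtain u v where uv: "u \<in> S" "v \<in> S" "x = sympl_shift e l u" "y = sympl_shift e l v" by auto
  then have "x + y = sympl_shift e l (u + v)"
    by (simp add: sympl_shift_def symp_linear vec.scale_left_distrib)
  then show "x + y \<in> sympl_shift e l ` S" using uv assms by (simp add: vec.subspace_add)
next
  fix a x assume "x \<in> sympl_shift e l ` S"
  then obtain u where u: "u \<in> S" "x = sympl_shift e l u" by auto
  then have "a *s x = sympl_shift e l (a *s u)"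
    by (simp add: sympl_shift_def symp_linear vec.scale_right_distrib)
  then show "a *s x \<in> sympl_shift e l ` S" using u assms by (simp add: vec.subspace_scale)
qed

lemma symp_dual_sympl_shift:
  fixes S :: "('a::finite_field, 'n::finite) spvec set"
  assumes tr: "\<exists>x::'a. abs_trace x \<noteq> 0" and el: "symp_form e l = 0" and S: "vec.subspace S"
  shows "symp_dual (sympl_shift e l ` S) = sympl_shift e l ` symp_dual S"
proof -
  have "surj (sympl_shift e l)"
    using inj_sympl_shift[OF el] by (simp add: finite_UNIV_inj_surj)
  then have "\<exists>u. v = sympl_shift e l u" for v by blast
  then show ?thesis
    unfolding symp_dual_subspace_eq[OF S tr]
      symp_dual_subspace_eq[OF subspace_sympl_shift[OF S] tr]
    using symp_sympl_shift[OF el] by fastforce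
qed

lemma swt_change_one_coordinate:
  assumes "\<And>j. j \<noteq> i \<Longrightarrow> u $ Inl j = v $ Inl j \<and> u $ Inr j = v $ Inr j"
  shows "swt u \<le> swt v + 1"
proof -
  have "swt u \<le> card (insert i {j. (v $ Inl j, v $ Inr j) \<noteq> (0, 0)})"
    unfolding swt_def by (rule card_mono) (use assms in auto)
  also have "\<dots> \<le> swt v + 1"
    unfolding swt_def by (simp add: card_insert_if)
  finally show ?thesis .
qed

text \<open>The form pairs \<open>Inl i\<close> with \<open>Inr i\<close>, so a nonzero entry of
  \<open>c\<close> is detected by the unit vector at the same \<open>i\<close> in the other
  half.\<close>

lemma nonzero_unit_pairing:
  fixes c :: "('a::finite_field, 'n::finite) spvec"
  assumes "c \<noteq> 0"
  obtains i and l :: "('a, 'n) spvec"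
  where "symp_form c l \<noteq> 0" "\<And>j. j \<noteq> i \<Longrightarrow> l $ Inl j = 0 \<and> l $ Inr j = 0"
proof -
  obtain s where "c $ s \<noteq> 0" using assms by (auto simp: vec_eq_iff)
  then consider i where "s = Inl i" "c $ Inl i \<noteq> 0" | i where "s = Inr i" "c $ Inr i \<noteq> 0"
    by (cases s) auto
  then show ?thesis
  proof cases
    case (1 i)
    then show ?thesis by (intro that[of "axis (Inr i) 1" i]) (simp_all add: symp_unit_vectors, simp_all add: axis_def)
  next
    case (2 i)
    then show ?thesis by (intro that[of "axis (Inl i) 1" i]) (simp_all add: symp_unit_vectors, simp_all add: axis_def)
  qed
qed

text \<open>The plane spanned by \<open>c\<close> and \<open>f\<close> meets the hyperplane
  orthogonal to \<open>l\<close>; \<open>h\<close> certifies that \<open>e\<close> is not in the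
  radical.\<close>

lemma orthogonal_outside_radical:
  assumes C: "vec.subspace C" and cf: "c \<in> C" "f \<in> C" "symp_form c f \<noteq> 0"
  obtains e h where "e \<in> C" "h \<in> C" "symp_form e h \<noteq> 0" "symp_form e l = 0"
proof (cases "symp_form c l = 0")
  case True
  then show ?thesis using that cf by blast
next
  case False
  define e where "e = symp_form f l *s c - symp_form c l *s f"
  have e: "e = symp_form f l *s c + (- symp_form c l) *s f"
    by (simp add: e_def)
  have fc: "symp_form f c \<noteq> 0" using cf(3) symp_eq_0_commute by blast
  have "e \<in> C" unfolding e_def using C cf by (intro vec.subspace_diff vec.subspace_scale)
  moreover have "symp_form e l = 0" unfolding e symp_linear by simp
  moreover have "symp_form e c \<noteq> 0" unfolding e symp_linear using False fc by simp
  ultimately show ?thesis using that cf(1) by blast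
qed

lemma shifted_code:
  fixes C :: "('a::finite_field, 'n::finite) spvec set"
  assumes C: "vec.subspace C" and D: "D = {v \<in> C. \<forall>w\<in>C. symp_form v w = 0}"
    and wt: "\<And>x. x \<in> C \<Longrightarrow> x \<noteq> 0 \<Longrightarrow> d \<le> swt x"
    and min_in_D: "\<And>x. x \<in> C \<Longrightarrow> x \<noteq> 0 \<Longrightarrow> swt x = d \<Longrightarrow> x \<in> D"
    and c: "c \<in> D" and cl: "symp_form c l \<noteq> 0"
    and l: "\<And>j. j \<noteq> i \<Longrightarrow> l $ Inl j = 0 \<and> l $ Inr j = 0"
    and e: "e \<in> C" "e \<notin> D" and el: "symp_form e l = 0"
  shows "\<And>y. y \<in> sympl_shift e l ` C \<Longrightarrow> y \<noteq> 0 \<Longrightarrow> d \<le> swt y"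
    and "c \<in> sympl_shift e l ` C" and "c \<notin> sympl_shift e l ` D"
proof -
  have D_sub: "vec.subspace D"
    using C by (auto simp: D vec.subspace_def symp_linear)
  \<comment> \<open>The preimage of \<open>c\<close>: as \<open>c\<close> is orthogonal to
    \<open>e\<close>, the shift only adds back the multiple of \<open>e\<close> removed
    here.\<close>
  define u where "u = c + (- symp_form c l) *s e"
  have ce: "symp_form c e = 0" using c e by (simp add: D)
  have "symp_form u e = 0" "symp_form u l = symp_form c l"
    unfolding u_def symp_linear using ce el by simp_all
  then have cu: "c = sympl_shift e l u" by (simp add: sympl_shift_def u_def)
  have "u \<in> C"
    unfolding u_def using C c e by (intro vec.subspace_add vec.subspace_scale) (auto simp: D)
  then show "c \<in> sympl_shift e l ` C" using cu by blast
  show "c \<notin> sympl_shift e l ` D"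
  proof
    assume "c \<in> sympl_shift e l ` D"
    then have "u \<in> D" using cu inj_sympl_shift[OF el] by (metis imageE injD)
    then have "c - u \<in> D" using c D_sub by (simp add: vec.subspace_diff)
    then have "symp_form c l *s e \<in> D" by (simp add: u_def)
    then have "(1 / symp_form c l) *s (symp_form c l *s e) \<in> D"
      by (rule vec.subspace_scale[OF D_sub])
    then show False using cl e by simp
  qed
  fix y assume y: "y \<in> sympl_shift e l ` C" "y \<noteq> 0"
  then obtain u0 where u0: "u0 \<in> C" "y = sympl_shift e l u0" by blast
  \<comment> \<open>The \<open>e\<close> term stays inside \<open>C\<close> and does not change the
    pairing with \<open>e\<close>, so only a multiple of \<open>l\<close> separates \<open>y\<close>
    from a vector of \<open>C\<close>.\<close>
  define u1 where "u1 = u0 + symp_form u0 l *s e"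
  have u1: "u1 \<in> C"
    unfolding u1_def using C u0 e by (intro vec.subspace_add vec.subspace_scale)
  have y1: "y = u1 + symp_form u1 e *s l"
    by (simp add: u0 u1_def sympl_shift_def symp_linear)
  have "u1 \<noteq> 0" using y1 y(2) by auto
  then consider "u1 \<in> D" | "d + 1 \<le> swt u1"
    using wt[OF u1] min_in_D[OF u1] by fastforce
  then show "d \<le> swt y"
  proof cases
    case 1
    then have "y = u1" using e y1 by (simp add: D)
    then show ?thesis using wt u1 y(2) by blast
  next
    case 2
    have "swt u1 \<le> swt y + 1"
      by (rule swt_change_one_coordinate[of i]) (simp add: y1 l)
    then show ?thesis using 2 by simp
  qed
qed

theorem theorem13:
  fixes p m q n k r d :: nat
  assumes "prime p" and "m > 0" and "q = p ^ m"
    and "CARD('a::finite_field) = q"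
    and "r > 0"
    and "\<exists>C :: ('a, 'n::finite) spvec set. pure_linear_subsystem_code C n k r d"
  shows "\<exists>C :: ('a, 'n) spvec set. pure_linear_subsystem_code C n (k + 1) (r - 1) d"
proof -
  have tr: "\<exists>x::'a. abs_trace x \<noteq> 0"
    using abs_trace_nonzero[OF card_eq_CHAR_power] assms by blast
  obtain C :: "('a, 'n) spvec set" where "pure_linear_subsystem_code C n k r d"
    using assms(6) by blast
  then have code: "subsystem_code C n (CARD('a) ^ k) (CARD('a) ^ r) d"
    and C: "vec.subspace C" and pure: "pure_to C d"
    by (auto simp: pure_linear_subsystem_code_def)
  define D where "D = C \<inter> symp_dual C"
  have n: "n = CARD('n)"
    and cardC: "real (card C) = real CARD('a) ^ n * real (CARD('a) ^ r) / real (CARD('a) ^ k)"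
    and cardD: "real (card D) = real CARD('a) ^ n / (real (CARD('a) ^ k) * real (CARD('a) ^ r))"
    and d: "d = (if symp_dual D \<noteq> C then min_swt (symp_dual D - C) else min_swt (symp_dual D))"
    using code by (auto simp: subsystem_code_def Let_def D_def)
  have D: "D = {v \<in> C. \<forall>w\<in>C. symp_form v w = 0}"
    unfolding D_def symp_dual_subspace_eq[OF C tr] by auto
  have D_sub: "vec.subspace D"
    using C by (auto simp: D vec.subspace_def symp_linear)
  have CD: "C \<subseteq> symp_dual D"
    unfolding symp_dual_subspace_eq[OF D_sub tr] by (auto simp: D symp_eq_0_commute)
  have wtC: "d \<le> swt x" if "x \<in> C" "x \<noteq> 0" for x
    using pure that by (simp add: pure_to_def not_less)
  \<comment> \<open>Equality would force \<open>Q ^ (2 * r) = 1\<close>, against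
    \<open>r > 0\<close>; thus a hyperbolic pair exists.\<close>
  have "C \<noteq> D"
  proof
    assume "C = D"
    define Q where "Q = real CARD('a)"
    have "card {0::'a, 1} \<le> CARD('a)" by (rule card_mono) auto
    then have Q: "Q > 1" by (simp add: Q_def)
    have "Q ^ n * Q ^ r / Q ^ k = Q ^ n / (Q ^ k * Q ^ r)"
      using cardC cardD \<open>C = D\<close> by (simp add: Q_def)
    then have "Q ^ r * Q ^ r = 1" using Q by (simp add: field_simps)
    moreover have "Q ^ r > 1" using Q assms(5) by (simp add: one_less_power)
    ultimately show False using mult_strict_mono[of 1 "Q ^ r" 1 "Q ^ r"] by simp
  qed
  then obtain c f where cf: "c \<in> C" "f \<in> C" "symp_form c f \<noteq> 0" using D by blast
  show ?thesis
  proof (cases "symp_dual D = C")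
    case False
    then have ne: "(symp_dual D - C) - {0} \<noteq> {}" using CD vec.subspace_0[OF C] by blast
    \<comment> \<open>Being outside \<open>C\<close>, this vector is outside every reduced code, so
      any hyperbolic pair serves.\<close>
    obtain x where x: "x \<in> symp_dual D" "x \<notin> C" "swt x = d"
      using min_swt_attained[OF ne] False d by auto
    have "d \<le> swt y" if "y \<in> symp_dual D" "y \<noteq> 0" for y
      using that wtC min_swt_le[of y "symp_dual D - C"] False d by (cases "y \<in> C") auto
    then show ?thesis
      using orth_pair_code[OF tr C cf n assms(5) D_def cardC cardD _ x(1) _ x(3)] x(2)
      by (auto simp: orth_pair_def)
  next
    case True
    have "C - {0} \<noteq> {}" using cf by auto
    then obtain x where x: "x \<in> C" "x \<noteq> 0" "swt x = d"
      using min_swt_attained True d by metis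
    show ?thesis
    proof (cases "\<exists>x\<in>C - D. swt x = d")
      case True
      \<comment> \<open>A minimum weight vector belongs to the pair itself: since it pairs
        nontrivially with \<open>f'\<close>, the reduction excludes it.\<close>
      then obtain c' f' where c': "c' \<in> C" "f' \<in> C" "symp_form c' f' \<noteq> 0" "swt c' = d"
        using D by blast
      then have "c' \<in> symp_dual D" "c' \<notin> orth_pair C c' f'"
        using CD by (auto simp: orth_pair_def)
      then show ?thesis
        using orth_pair_code[OF tr C c'(1-3) n assms(5) D_def cardC cardD _ _ _ c'(4)]
          wtC \<open>symp_dual D = C\<close> by blast
    next
      case False
      then have xD: "x \<in> D" using x by blast
      obtain i and l :: "('a, 'n) spvec" where xl: "symp_form x l \<noteq> 0"
        and l: "\<And>j. j \<noteq> i \<Longrightarrow> l $ Inl j = 0 \<and> l $ Inr j = 0"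
        using nonzero_unit_pairing[OF x(2)] by blast
      obtain e h where e: "e \<in> C" "h \<in> C" "symp_form e h \<noteq> 0" "symp_form e l = 0"
        using orthogonal_outside_radical[OF C cf] by blast
      have eD: "e \<notin> D" using e by (auto simp: D)
      let ?g = "sympl_shift e l"
      have gC: "vec.subspace (?g ` C)" using C by (rule subspace_sympl_shift)
      note inj = inj_sympl_shift[OF e(4)]
      have gD: "?g ` D = ?g ` C \<inter> symp_dual (?g ` C)"
        unfolding D_def symp_dual_sympl_shift[OF tr e(4) C] using inj by (rule image_Int)
      have gDd: "symp_dual (?g ` D) = ?g ` C"
        unfolding symp_dual_sympl_shift[OF tr e(4) D_sub] True ..
      have cards: "card (?g ` C) = card C" "card (?g ` D) = card D"
        using inj by (meson card_image inj_on_subset subset_UNIV)+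
      note shifted = shifted_code[OF C D wtC _ xD xl l e(1) eD e(4)]
      have wt: "d \<le> swt y" if "y \<in> ?g ` C" "y \<noteq> 0" for y
        using shifted(1) False that by blast
      have xg: "x \<in> ?g ` C" "x \<notin> ?g ` D"
        using shifted(2,3) False by blast+
      obtain h' where h': "h' \<in> ?g ` C" "symp_form x h' \<noteq> 0"
        using xg unfolding gD symp_dual_subspace_eq[OF gC tr] by blast
      have "x \<notin> orth_pair (?g ` C) x h'" using h' by (simp add: orth_pair_def)
      then have "pure_linear_subsystem_code (orth_pair (?g ` C) x h') n (k + 1) (r - 1) d"
        using orth_pair_code[OF tr gC xg(1) h' n assms(5) gD] cardC cardD wt xg(1) x(3)
        unfolding gDd cards by blast
      then show ?thesis by blast
    qed
  qed
qed

end
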